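(* Let $n\ge1$ be an integer not divisible by $3$. There is a unique bijection $\phi$ from the set of $(3,n)$-Dyck paths to itself such that for every $(3,n)$-Dyck path $\Pi$: $\operatorname{area}(\phi(\Pi))=\operatorname{dinv}(\Pi)$, $\operatorname{dinv}(\phi(\Pi))=\operatorname{area}(\Pi)$, and $\operatorname{skip}(\phi(\Pi))=\operatorname{skip}(\Pi)$.
   Context: A $(3,n)$-Dyck path is a lattice path from $(0,0)$ to $(3,n)$ using unit north and east steps that stays weakly above the line $y=\frac{n}{3}x$. The cell $(a,b)$ ($a\in\{1,2,3\}$ column from left, $b\in\{1,\dots,n\}$ row from bottom) is $[a-1,a]\times[b-1,b]$. For a path $\Pi$, $\lambda(\Pi)$ is the set of cells lying above (north-west of) $\Pi$. $\operatorname{area}(\Pi)$ is the number of cells lying entirely below $\Pi$ and above the line $y=\frac n3x$. For $x\in\lambda(\Pi)$, $\operatorname{arm}(x)$ (resp. $\operatorname{leg}(x)$) is the number of cells of $\lambda(\Pi)$ strictly east (resp. strictly south) of $x$ in its row (resp. column). $\operatorname{dinv}(\Pi)$ is the number of $x\in\lambda(\Pi)$ with $\frac{\operatorname{arm}(x)}{\operatorname{leg}(x)+1}<\frac{3}{n}<\frac{\operatorname{arm}(x)+1}{\operatorname{leg}(x)}$ (right side $+\infty$ if $\operatorname{leg}(x)=0$). The rank of cell $(a,b)$ is $-an+3(b-1)$. The rank word of $\Pi$ is the list of all positive ranks of cells (these lie in columns 1 and 2 and are distinct) written in increasing order, where each entry whose cell lies in $\lambda(\Pi)$ is marked ("boxed").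 A skip of $\Pi$ is a maximal block of consecutive unboxed entries of the rank word that has at least one boxed entry somewhere to its left and at least one boxed entry somewhere to its right; $\operatorname{skip}(\Pi)$ is the number of skips. *)

theory Defs
  imports Complex_Main "HOL-Library.FuncSet"
begin

datatype step = North | East

text \<open>
  A path is a list of unit steps starting at the origin; after its first \<open>i\<close> steps it is at
  the lattice point \<open>(x_coord P i, y_coord P i)\<close>.
\<close>

type_synonym path = "step list"

definition x_coord :: "path \<Rightarrow> nat \<Rightarrow> nat" where
  "x_coord P i = count_list (take i P) East"

definition y_coord :: "path \<Rightarrow> nat \<Rightarrow> nat" where
  "y_coord P i = count_list (take i P) North"

text \<open>
  A path stays weakly above the line exactly when all of its lattice points do, since its
  edges are straight segments between consecutive lattice points.
\<close>

definition dyck_paths :: "nat \<Rightarrow> path set" where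
  "dyck_paths n = {P. count_list P East = 3 \<and> count_list P North = n \<and>
     (\<forall>i\<le>length P. real (y_coord P i) \<ge> real n / 3 * real (x_coord P i))}"

text \<open>The cell \<open>(a, b)\<close> is the unit square \<open>[a-1,a] \<times> [b-1,b]\<close>.\<close>

type_synonym cell = "nat \<times> nat"

definition cells :: "nat \<Rightarrow> cell set" where
  "cells n = {1..3} \<times> {1..n}"

text \<open>
  A cell lies above a path iff it lies above the unique east step of the path in the column
  of the cell. All other cells of the grid lie entirely below the path.
\<close>

definition cells_above :: "nat \<Rightarrow> path \<Rightarrow> cell set" where
  "cells_above n P = {(a, b) \<in> cells n. \<exists>i<length P.
     P ! i = East \<and> x_coord P i = a - 1 \<and> y_coord P i \<le> b - 1}"

text \<open>
  A cell lies entirely above the line \<open>y = (n/3) x\<close> iff its south-east corner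
  \<open>(a, b - 1)\<close> lies weakly above it.
\<close>

definition area :: "nat \<Rightarrow> path \<Rightarrow> nat" where
  "area n P = card {(a, b) \<in> cells n - cells_above n P. real b - 1 \<ge> real n / 3 * real a}"

definition arm :: "nat \<Rightarrow> path \<Rightarrow> cell \<Rightarrow> nat" where
  "arm n P c = card {d \<in> cells_above n P. snd d = snd c \<and> fst d > fst c}"

definition leg :: "nat \<Rightarrow> path \<Rightarrow> cell \<Rightarrow> nat" where
  "leg n P c = card {d \<in> cells_above n P. fst d = fst c \<and> snd d < snd c}"

definition dinv :: "nat \<Rightarrow> path \<Rightarrow> nat" where
  "dinv n P = card {c \<in> cells_above n P.
     real (arm n P c) / (real (leg n P c) + 1) < 3 / real n \<and>
     (leg n P c = 0 \<or> 3 / real n < (real (arm n P c) + 1) / real (leg n P c))}"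

definition rank :: "nat \<Rightarrow> cell \<Rightarrow> int" where
  "rank n = (\<lambda>(a, b). - int a * int n + 3 * (int b - 1))"

text \<open>
  Each entry of the rank word is paired with its mark. If \<open>n\<close> is not divisible by 3, then
  distinct cells of positive rank have distinct ranks, so that a rank determines its cell.
\<close>

definition rank_word :: "nat \<Rightarrow> path \<Rightarrow> (int \<times> bool) list" where
  "rank_word n P =
     map (\<lambda>r. (r, \<exists>c \<in> cells_above n P. rank n c = r))
       (sorted_list_of_set {r \<in> rank n ` cells n. r > 0})"

definition boxed :: "nat \<Rightarrow> path \<Rightarrow> nat \<Rightarrow> bool" where
  "boxed n P k \<longleftrightarrow> snd (rank_word n P ! k)"

text \<open>A skip is given by the positions \<open>i \<le> j\<close> of its first and its last entry.\<close>

definition skips :: "nat \<Rightarrow> path \<Rightarrow> (nat \<times> nat) set" where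
  "skips n P = {(i, j). i \<le> j \<and> j < length (rank_word n P) \<and>
     (\<forall>k\<in>{i..j}. \<not> boxed n P k) \<and>
     (i = 0 \<or> boxed n P (i - 1)) \<and>
     (j + 1 = length (rank_word n P) \<or> boxed n P (j + 1)) \<and>
     (\<exists>k<i. boxed n P k) \<and>
     (\<exists>k>j. k < length (rank_word n P) \<and> boxed n P k)}"

definition skip :: "nat \<Rightarrow> path \<Rightarrow> nat" where
  "skip n P = card (skips n P)"

end

(*
  A path is determined by the numbers c and c + d of cells above it in its second and first
  column. With k = n div 3, the three statistics are explicit piecewise linear functions of
  (c, d), and (area, dinv, skip) maps the paths bijectively onto the set of all (a, v, s) with
  a + v + s = n - 1 and s \<le> min a v. The symmetry of this set in a and v gives
  existence, and injectivity gives uniqueness.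
*)

theory Submission
  imports Defs
begin

section \<open>Paths as pairs of column counts\<close>

definition dyck_path :: "nat \<Rightarrow> nat \<Rightarrow> nat \<Rightarrow> path" where
  "dyck_path n c d =
     replicate (n - c - d) North @ East # replicate d North @ East # replicate c North @ [East]"

text \<open>The inequalities place the endpoints \<open>(2, n - c)\<close> and
  \<open>(1, n - c - d)\<close> of the second and first east steps weakly above the line. The second
  one also gives \<open>c + d <= n\<close>, so the subtraction in \<open>dyck_path\<close> is not
  truncated.\<close>

definition dyck_params :: "nat \<Rightarrow> (nat \<times> nat) set" where
  "dyck_params n = {(c, d). 3 * c \<le> n \<and> 3 * (c + d) \<le> 2 * n}"

lemma count_list_replicate: "count_list (replicate m x) y = (if x = y then m else 0)"
  by (induction m) auto

lemma not_East_eq_replicate: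
  assumes "East \<notin> set P"
  shows "P = replicate (length P) North"
  using assms by (metis replicate_length_same step.exhaust)

lemma split_first_East:
  assumes "count_list P East = Suc m"
  obtains a Q where "P = replicate a North @ East # Q" "count_list Q East = m"
proof -
  have "East \<in> set P"
    using assms by (metis count_list_0_iff nat.distinct(1))
  then obtain A Q where P: "P = A @ East # Q" "East \<notin> set A"
    by (meson split_list_first)
  then have "A = replicate (length A) North" "count_list A East = 0"
    using not_East_eq_replicate by (auto simp: count_list_0_iff)
  then show thesis
    using that[of "length A" Q] P assms by simp
qed

lemma weakly_above_line_iff: "real n / 3 * real x \<le> real y \<longleftrightarrow> n * x \<le> 3 * y"
proof -
  have "real n / 3 * real x \<le> real y \<longleftrightarrow> real (n * x) \<le> real (3 * y)"
    by (simp add: field_simps)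
  then show ?thesis
    by (simp only: of_nat_le_iff)
qed

lemma mem_dyck_paths_iff:
  "P \<in> dyck_paths n \<longleftrightarrow> count_list P East = 3 \<and> count_list P North = n \<and>
     (\<forall>i\<le>length P. n * x_coord P i \<le> 3 * y_coord P i)"
  unfolding dyck_paths_def weakly_above_line_iff mem_Collect_eq ..

lemma dyck_pathE:
  assumes "P \<in> dyck_paths n"
  obtains c d where "(c, d) \<in> dyck_params n" "P = dyck_path n c d"
proof -
  have E: "count_list P East = Suc (Suc (Suc 0))" and N: "count_list P North = n"
    and line: "\<And>i. i \<le> length P \<Longrightarrow> n * x_coord P i \<le> 3 * y_coord P i"
    using assms unfolding mem_dyck_paths_iff by simp_all
  obtain a P1 where P1: "P = replicate a North @ East # P1" "count_list P1 East = Suc (Suc 0)"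
    using E by (rule split_first_East)
  obtain d P2 where P2: "P1 = replicate d North @ East # P2" "count_list P2 East = Suc 0"
    using P1(2) by (rule split_first_East)
  obtain c P3 where P3: "P2 = replicate c North @ East # P3" "count_list P3 East = 0"
    using P2(2) by (rule split_first_East)
  obtain e where P4: "P3 = replicate e North"
    using P3(2) not_East_eq_replicate by (metis count_list_0_iff)
  have P: "P = replicate a North @ East # replicate d North @ East # replicate c North
      @ East # replicate e North"
    using P1 P2 P3 P4 by simp
  have sum: "a + d + c + e = n"
    using N by (simp add: P count_list_replicate)
  \<comment> \<open>The prefix \<open>A\<close> ends with the third east step, at the point
    \<open>(3, a + d + c)\<close>. The line already has height \<open>n\<close> there, so no north
    step can follow.\<close>
  define A where
    "A = replicate a North @ East # replicate d North @ East # replicate c North @ [East]"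
  have "P = A @ replicate e North" "count_list A East = 3" "count_list A North = a + d + c"
    by (simp_all add: P A_def count_list_replicate)
  then have "n * 3 \<le> 3 * (a + d + c)"
    using line[of "length A"] by (simp add: x_coord_def y_coord_def)
  with sum have e: "e = 0" by simp
  have 1: "n \<le> 3 * a"
    using line[of "a + 1"] by (simp add: P x_coord_def y_coord_def count_list_replicate)
  have 2: "n * 2 \<le> 3 * (a + d)"
    using line[of "a + Suc (d + Suc 0)"] by (simp add: P x_coord_def y_coord_def count_list_replicate)
  have "(c, d) \<in> dyck_params n"
    using 1 2 sum e by (auto simp: dyck_params_def)
  moreover have "P = dyck_path n c d"
    using sum e by (simp add: P dyck_path_def flip: sum)
  ultimately show thesis by (rule that)
qed

lemma dyck_path_in_dyck_paths:
  assumes "(c, d) \<in> dyck_params n"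
  shows "dyck_path n c d \<in> dyck_paths n"
proof -
  define a where "a = n - c - d"
  have n: "n = a + c + d" and 1: "n \<le> 3 * a" and 2: "n * 2 \<le> 3 * (a + d)"
    using assms by (auto simp: dyck_params_def a_def)
  have P: "dyck_path n c d =
      replicate a North @ East # replicate d North @ East # replicate c North @ [East]"
    by (simp add: dyck_path_def a_def)
  have "n * x_coord (dyck_path n c d) i \<le> 3 * y_coord (dyck_path n c d) i" for i
  proof -
    \<comment> \<open>The cases distinguish how many east steps have been taken: 0, 1, 2 or 3. The
      indices are written with \<open>Suc\<close> so that simplification can push
      \<open>take\<close> through each \<open>replicate\<close> and each \<open>East\<close>; the
      last case also covers indices beyond the end of the path.\<close>
    consider "i \<le> a" | j where "i = a + Suc j" "j \<le> d"
      | j where "i = a + Suc (d + Suc j)" "j \<le> c" | j where "i = a + Suc (d + Suc (c + Suc j))"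
    proof -
      consider "i \<le> a" | "a < i" "i \<le> a + d + 1" | "a + d + 1 < i" "i \<le> a + d + c + 2"
        | "a + d + c + 2 < i" by linarith
      then show thesis
      proof cases
        case 2
        then show thesis by (intro that(2)[of "i - a - 1"]) auto
      next
        case 3
        then show thesis by (intro that(3)[of "i - a - d - 2"]) auto
      next
        case 4
        then show thesis by (intro that(4)[of "i - a - d - c - 3"]) auto
      qed (rule that(1))
    qed
    then show ?thesis
      using 1 2 unfolding x_coord_def y_coord_def P
      by cases (simp_all add: n count_list_replicate)
  qed
  moreover have "count_list (dyck_path n c d) East = 3"
    "count_list (dyck_path n c d) North = a + c + d"
    unfolding P by (simp_all add: count_list_replicate)
  ultimately show ?thesis
    using n by (simp add: mem_dyck_paths_iff)
qed

lemma dyck_paths_eq: "dyck_paths n = (\<lambda>(c, d). dyck_path n c d) ` dyck_params n"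
  by (auto elim: dyck_pathE simp: dyck_path_in_dyck_paths)

section \<open>Cells above a path, area and dinv\<close>

lemma cells_above_dyck_path:
  assumes "(c, d) \<in> dyck_params n"
  shows "cells_above n (dyck_path n c d) = {1} \<times> {n - c - d<..n} \<union> {2} \<times> {n - c<..n}"
proof -
  define a where "a = n - c - d"
  have n: "n = a + c + d"
    using assms by (auto simp: dyck_params_def a_def)
  let ?P = "dyck_path n c d"
  have P: "?P = replicate a North @ East # replicate d North @ East # replicate c North @ [East]"
    by (simp add: dyck_path_def a_def)
  have East: "i < length ?P \<and> ?P ! i = East \<longleftrightarrow> i = a \<or> i = a + Suc d \<or> i = a + Suc (d + Suc c)" for i
    unfolding P by (auto simp: nth_append nth_Cons split: nat.splits if_splits)
  \<comment> \<open>The three east steps run at heights \<open>a\<close>, \<open>a + d\<close> and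
    \<open>n\<close>. The last of them is on the top edge of the grid, so the third column has no
    cell above the path.\<close>
  have *: "(\<exists>i<length ?P. ?P ! i = East \<and> x_coord ?P i = x \<and> y_coord ?P i \<le> y) \<longleftrightarrow>
    x = 0 \<and> a \<le> y \<or> x = 1 \<and> a + d \<le> y \<or> x = 2 \<and> n \<le> y" for x y
  proof -
    have "(\<exists>i<length ?P. ?P ! i = East \<and> x_coord ?P i = x \<and> y_coord ?P i \<le> y) \<longleftrightarrow>
       (\<exists>i. (i < length ?P \<and> ?P ! i = East) \<and> x_coord ?P i = x \<and> y_coord ?P i \<le> y)"
      by blast
    also have "\<dots> \<longleftrightarrow> (\<exists>i\<in>{a, a + Suc d, a + Suc (d + Suc c)}. x_coord ?P i = x \<and> y_coord ?P i \<le> y)"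
      unfolding East by auto
    also have "\<dots> \<longleftrightarrow> x = 0 \<and> a \<le> y \<or> x = 1 \<and> a + d \<le> y \<or> x = 2 \<and> n \<le> y"
      unfolding P using n by (auto simp: x_coord_def y_coord_def count_list_replicate)
    finally show ?thesis .
  qed
  show ?thesis
    unfolding cells_above_def * using n by (auto simp: cells_def a_def)
qed

text \<open>The grid has \<open>n - 1\<close> whole cells above the line, and each of the
  \<open>2 * c + d\<close> cells above the path removes one of them.\<close>

lemma area_dyck_path:
  assumes cd: "(c, d) \<in> dyck_params n" and n: "n = 3 * k + e" "e = 1 \<or> e = 2"
  shows "area n (dyck_path n c d) = n - 1 - 2 * c - d"
proof -
  let ?P = "dyck_path n c d"
  \<comment> \<open>\<open>k\<close> and \<open>?K\<close> are the integer parts of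
    \<open>n / 3\<close> and \<open>2 * n / 3\<close>. As neither quotient is an integer, a cell
    above the line in column 1 or 2 needs \<open>b - 1\<close> strictly greater than this integer
    part.\<close>
  let ?K = "2 * k + e - 1"
  have line: "real b - 1 \<ge> real n / 3 * real a \<longleftrightarrow> n * a \<le> 3 * (b - 1)" if "1 \<le> b" for a b
    using weakly_above_line_iff[of n a "b - 1"] that by (simp add: of_nat_diff)
  have "{(a, b) \<in> cells n - cells_above n ?P. real b - 1 \<ge> real n / 3 * real a} =
      {(a, b) \<in> cells n - cells_above n ?P. n * a \<le> 3 * (b - 1)}"
    using line by (auto simp: cells_def)
  also have "\<dots> = {1} \<times> {k + 1<..n - c - d} \<union> {2} \<times> {?K + 1<..n - c}" (is "?L = ?R")
  proof (rule set_eqI)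
    fix x :: cell
    obtain a b where x: "x = (a, b)" by force
    consider "a = 1" | "a = 2" | "a = 3" | "a \<notin> {1..3}" by force
    then show "x \<in> ?L \<longleftrightarrow> x \<in> ?R"
      by cases (use cd n in \<open>auto simp: x cells_above_dyck_path cells_def dyck_params_def\<close>)
  qed
  also have "card \<dots> = (n - c - d - (k + 1)) + (n - c - (?K + 1))"
    by (subst card_Un_disjoint) auto
  also have "\<dots> = n - 1 - 2 * c - d"
    using cd n by (auto simp: dyck_params_def)
  finally show ?thesis
    by (simp add: area_def)
qed

lemma arm_dyck_path:
  assumes "(c, d) \<in> dyck_params n" "1 \<le> a"
  shows "arm n (dyck_path n c d) (a, b) = (if a = 1 \<and> n - c < b \<and> b \<le> n then 1 else 0)"
proof -
  have "{x \<in> cells_above n (dyck_path n c d). snd x = b \<and> fst x > a} =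
      (if a = 1 \<and> n - c < b \<and> b \<le> n then {(2, b)} else {})"
    using assms by (auto simp: cells_above_dyck_path)
  then show ?thesis
    by (simp add: arm_def)
qed

lemma leg_dyck_path:
  assumes "(c, d) \<in> dyck_params n" "b \<le> n"
  shows "leg n (dyck_path n c d) (1, b) = b - 1 - (n - c - d)"
    and "leg n (dyck_path n c d) (2, b) = b - 1 - (n - c)"
proof -
  have "{x \<in> cells_above n (dyck_path n c d). fst x = 1 \<and> snd x < b} = {1} \<times> {n - c - d<..<b}"
    "{x \<in> cells_above n (dyck_path n c d). fst x = 2 \<and> snd x < b} = {2} \<times> {n - c<..<b}"
    using assms by (auto simp: cells_above_dyck_path)
  then show "leg n (dyck_path n c d) (1, b) = b - 1 - (n - c - d)"
    "leg n (dyck_path n c d) (2, b) = b - 1 - (n - c)"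
    by (simp_all add: leg_def card_cartesian_product)
qed

text \<open>Clearing denominators absorbs the exceptional case of leg zero: for \<open>l = 0\<close>
  the second inequality on the right is automatic because \<open>n > 0\<close>.\<close>

lemma slope_condition_iff:
  assumes "n > 0"
  shows "real a / (real l + 1) < 3 / real n \<and> (l = 0 \<or> 3 / real n < (real a + 1) / real l) \<longleftrightarrow>
    n * a < 3 * (l + 1) \<and> 3 * l < n * (a + 1)"
proof -
  have "real a / (real l + 1) < 3 / real n \<longleftrightarrow> real (n * a) < real (3 * (l + 1))"
    using assms by (simp add: field_simps)
  moreover have "l = 0 \<or> 3 / real n < (real a + 1) / real l \<longleftrightarrow> real (3 * l) < real (n * (a + 1))"
    using assms by (cases "l = 0") (simp_all add: field_simps add_pos_nonneg)
  ultimately show ?thesis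
    unfolding of_nat_less_iff by blast
qed

text \<open>The summands count three blocks of cells. In column 2 the arm is 0 and the leg is below
  \<open>c <= k\<close>, so all \<open>c\<close> cells count. The lowest \<open>d\<close> cells of
  column 1 have arm 0 and legs \<open>0, ..., d - 1\<close>, and count when the leg is at most
  \<open>k\<close>. The top \<open>c\<close> cells of column 1 have arm 1 and legs
  \<open>d, ..., c + d - 1\<close>, and count when the leg is at least \<open>k\<close>; the upper
  bound on the leg follows from \<open>3 * (c + d) <= 2 * n\<close>.\<close>

lemma dinv_dyck_path:
  assumes cd: "(c, d) \<in> dyck_params n" and n: "n = 3 * k + e" "e = 1 \<or> e = 2"
  shows "dinv n (dyck_path n c d) = c + min d (k + 1) + (c + d - max d k)"
proof -
  let ?P = "dyck_path n c d"
  let ?h = "n - c - d"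
  have "n > 0" using n by auto
  have le: "3 * c \<le> n" "3 * (c + d) \<le> 2 * n"
    using cd by (auto simp: dyck_params_def)
  have "{x \<in> cells_above n ?P. real (arm n ?P x) / (real (leg n ?P x) + 1) < 3 / real n \<and>
     (leg n ?P x = 0 \<or> 3 / real n < (real (arm n ?P x) + 1) / real (leg n ?P x))} =
     {x \<in> cells_above n ?P. n * arm n ?P x < 3 * (leg n ?P x + 1) \<and>
        3 * leg n ?P x < n * (arm n ?P x + 1)}"
    unfolding slope_condition_iff[OF \<open>n > 0\<close>] ..
  also have "\<dots> = {2} \<times> {n - c<..n} \<union>
      ({1} \<times> {?h<..min (n - c) (?h + k + 1)} \<union> {1} \<times> {max (n - c) (?h + k)<..n})"
    (is "?L = ?R")
  proof (rule set_eqI)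
    fix x :: cell
    obtain a b where x: "x = (a, b)" by force
    consider "a = 1" | "a = 2" | "a \<notin> {1, 2}" by force
    then show "x \<in> ?L \<longleftrightarrow> x \<in> ?R"
    proof cases
      case 1
      have *: "x \<in> ?L \<longleftrightarrow> ?h < b \<and> b \<le> n \<and>
          n * (if n - c < b then 1 else 0) < 3 * (b - 1 - ?h + 1) \<and>
          3 * (b - 1 - ?h) < n * ((if n - c < b then 1 else 0) + 1)"
        using leg_dyck_path(1)[OF cd, of b] arm_dyck_path[OF cd, of 1 b]
        by (auto simp: x 1 cells_above_dyck_path[OF cd] simp del: One_nat_def)
      show ?thesis
        unfolding * using le n by (cases "n - c < b") (auto simp: x 1)
    next
      case 2
      have *: "x \<in> ?L \<longleftrightarrow> n - c < b \<and> b \<le> n \<and> 3 * (b - 1 - (n - c)) < n"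
        using leg_dyck_path(2)[OF cd, of b] arm_dyck_path[OF cd, of 2 b]
        by (auto simp: x 2 cells_above_dyck_path[OF cd])
      show ?thesis
        unfolding * using le n by (auto simp: x 2)
    next
      case 3
      then show ?thesis by (auto simp: x cells_above_dyck_path[OF cd])
    qed
  qed
  also have "card \<dots> = c + (min d (k + 1) + (c + d - max d k))"
    using le n by (subst card_Un_disjoint; (subst card_Un_disjoint)?) (auto simp: min_def max_def)
  finally show ?thesis
    by (simp add: dinv_def)
qed

section \<open>Skips\<close>

text \<open>By maximality a skip is determined by its first position, so counting skips reduces to
  counting unboxed positions that directly follow a boxed one and have a boxed one later.\<close>

lemma skip_eq_card_starts:
  "skip n P = card {i. 0 < i \<and> i < length (rank_word n P) \<and> \<not> boxed n P i \<and> boxed n P (i - 1) \<and>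
     (\<exists>k>i. k < length (rank_word n P) \<and> boxed n P k)}" (is "_ = card ?S")
proof -
  have "inj_on fst (skips n P)"
  proof (rule inj_onI, clarify)
    \<comment> \<open>Of two skips with the same start, the boxed entry just after the shorter one
      would lie inside the longer one.\<close>
    have False if "(i, j) \<in> skips n P" "(i, j') \<in> skips n P" "j < j'" for i j j'
    proof -
      have "boxed n P (j + 1)" "j + 1 \<in> {i..j'}"
        using that by (auto simp: skips_def)
      then show False using that(2) by (auto simp: skips_def)
    qed
    then show "i = i' \<and> j = j'" if "(i, j) \<in> skips n P" "(i', j') \<in> skips n P"
      "fst (i, j) = fst (i', j')" for i j i' j'
      using that by (metis fst_conv linorder_neqE_nat)
  qed
  moreover have "fst ` skips n P = ?S"
  proof (intro equalityI subsetI)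
    fix i assume "i \<in> fst ` skips n P"
    then obtain j where j: "(i, j) \<in> skips n P" by auto
    then show "i \<in> ?S"
      by (auto simp: skips_def) (meson le_less_trans)
  next
    fix i assume i: "i \<in> ?S"
    \<comment> \<open>\<open>m\<close> is the next boxed position after \<open>i\<close>, so the
      skip starting at \<open>i\<close> ends at \<open>m - 1\<close>.\<close>
    define m where "m = (LEAST k. i < k \<and> boxed n P k)"
    obtain k where k: "i < k" "k < length (rank_word n P)" "boxed n P k"
      using i by auto
    have m: "i < m" "boxed n P m" "m \<le> k"
      using LeastI[of "\<lambda>k. i < k \<and> boxed n P k" k] Least_le[of "\<lambda>k. i < k \<and> boxed n P k" k] k
      by (auto simp: m_def)
    have "\<not> boxed n P l" if "l \<in> {i..m - 1}" for l
    proof (cases "l = i")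
      case False
      moreover have "l < m" using that m(1) by auto
      ultimately show ?thesis
        using not_less_Least[of l "\<lambda>k. i < k \<and> boxed n P k"] that by (simp flip: m_def)
    qed (use i in simp)
    moreover have "boxed n P (m - 1 + 1)" "i \<le> m - 1" "m - 1 < m" "m < length (rank_word n P)"
      using m k by auto
    moreover have "i - 1 < i" "boxed n P (i - 1)" using i by auto
    ultimately have "(i, m - 1) \<in> skips n P"
      using m(2) unfolding skips_def by (auto intro: exI[of _ m])
    then show "i \<in> fst ` skips n P" by force
  qed
  ultimately show ?thesis
    unfolding skip_def by (metis card_image)
qed

definition ranks :: "nat \<Rightarrow> int set" where
  "ranks n = {r \<in> rank n ` cells n. r > 0}"

text \<open>The word is strictly increasing, so positions can be replaced by the ranks stored there:
  the entry at \<open>i - 1\<close> becomes the greatest smaller element of \<open>ranks n\<close>.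
  Skips can then be computed without indexing into a sorted list.\<close>

lemma skip_eq_card_ranks:
  "skip n P = card {r \<in> ranks n. r \<notin> rank n ` cells_above n P \<and>
     (\<exists>p \<in> ranks n \<inter> rank n ` cells_above n P. p < r \<and> (\<forall>q\<in>ranks n. \<not> (p < q \<and> q < r))) \<and>
     (\<exists>q \<in> ranks n \<inter> rank n ` cells_above n P. r < q)}" (is "_ = card ?T")
proof -
  let ?B = "rank n ` cells_above n P"
  define xs where "xs = sorted_list_of_set (ranks n)"
  have "finite (ranks n)" by (simp add: ranks_def cells_def)
  then have set: "set xs = ranks n" and mono: "sorted_wrt (<) xs"
    by (simp_all add: xs_def)
  have less: "xs ! i < xs ! j \<longleftrightarrow> i < j" if "i < length xs" "j < length xs" for i j
    using mono that by (metis linorder_neqE_nat order_less_asym sorted_wrt_nth_less order_less_irrefl)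
  have len: "length (rank_word n P) = length xs"
    by (simp add: rank_word_def xs_def ranks_def)
  have boxed: "boxed n P i \<longleftrightarrow> xs ! i \<in> ?B" if "i < length xs" for i
    using that by (auto simp: boxed_def rank_word_def xs_def ranks_def image_iff eq_commute)
  let ?S = "{i. 0 < i \<and> i < length (rank_word n P) \<and> \<not> boxed n P i \<and> boxed n P (i - 1) \<and>
     (\<exists>k>i. k < length (rank_word n P) \<and> boxed n P k)}"
  have image: "(!) xs ` ?S = ?T"
  proof (intro equalityI subsetI)
    fix r assume "r \<in> (!) xs ` ?S"
    then obtain i k where r: "r = xs ! i" and i: "0 < i" "i < length xs" "xs ! i \<notin> ?B"
      "xs ! (i - 1) \<in> ?B" and k: "i < k" "k < length xs" "xs ! k \<in> ?B"
      by (auto simp: len boxed)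
    have "\<not> (xs ! (i - 1) < q \<and> q < r)" if "q \<in> ranks n" for q
    proof -
      obtain l where "q = xs ! l" "l < length xs"
        using \<open>q \<in> ranks n\<close> unfolding set[symmetric] in_set_conv_nth by blast
      then show ?thesis
        using i less[of "i - 1" l] less[of l i] by (auto simp: r)
    qed
    moreover have "xs ! (i - 1) < r" "r < xs ! k" "xs ! (i - 1) \<in> ranks n" "xs ! k \<in> ranks n"
      "r \<in> ranks n"
      using i k less[of "i - 1" i] less[of i k] by (simp_all add: r flip: set)
    ultimately show "r \<in> ?T" using i k by (auto simp: r)
  next
    fix r assume "r \<in> ?T"
    then obtain p q where r: "r \<in> ranks n" "r \<notin> ?B" and p: "p \<in> ranks n" "p \<in> ?B" "p < r"
      and gap: "\<And>q. q \<in> ranks n \<Longrightarrow> \<not> (p < q \<and> q < r)" and q: "q \<in> ranks n" "q \<in> ?B" "r < q"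
      by blast
    obtain i where i: "r = xs ! i" "i < length xs"
      using r(1) unfolding set[symmetric] in_set_conv_nth by blast
    obtain j where j: "p = xs ! j" "j < length xs"
      using p(1) unfolding set[symmetric] in_set_conv_nth by blast
    obtain k where k: "q = xs ! k" "k < length xs"
      using q(1) unfolding set[symmetric] in_set_conv_nth by blast
    have "j < i" "i < k" using less i j k p(3) q(3) by auto
    \<comment> \<open>Otherwise the rank at position \<open>i - 1\<close> would lie strictly between
      \<open>p\<close> and \<open>r\<close>.\<close>
    have "j = i - 1"
    proof (rule ccontr)
      assume "j \<noteq> i - 1"
      then have "j < i - 1" "i - 1 < i" "i - 1 < length xs" using \<open>j < i\<close> i by auto
      then show False
        using gap[of "xs ! (i - 1)"] less[of j "i - 1"] less[of "i - 1" i] i j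
        by (auto simp flip: set)
    qed
    then have "i \<in> ?S"
      using \<open>j < i\<close> \<open>i < k\<close> i j k r p q by (auto simp: len boxed)
    then show "r \<in> (!) xs ` ?S" using i by auto
  qed
  have inj: "inj_on ((!) xs) ?S"
    using less by (intro inj_onI) (metis (mono_tags, lifting) len linorder_neqE_nat mem_Collect_eq less_irrefl)
  show ?thesis
    unfolding skip_eq_card_starts image[symmetric] card_image[OF inj] ..
qed

text \<open>Here \<open>i\<close> counts cells from the top of a column, so
  \<open>b = n + 1 - i\<close>. Column 3 drops out because its ranks are \<open>- 3 * i\<close>; the
  bound \<open>i <= n\<close> follows from positivity of the rank.\<close>

lemma ranks_iff:
  "r \<in> ranks n \<longleftrightarrow> r > 0 \<and> (\<exists>i::nat. 1 \<le> i \<and> (r = 2 * int n - 3 * int i \<or> r = int n - 3 * int i))"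
proof
  assume r: "r \<in> ranks n"
  then obtain a b where ab: "a \<in> {1..3}" "b \<in> {1..n}" "r = rank n (a, b)"
    unfolding ranks_def cells_def by blast
  then have "r = - int a * int n + 3 * (int b - 1)" "r > 0" "a = 1 \<or> a = 2 \<or> a = 3"
    using r by (auto simp: rank_def ranks_def)
  then show "r > 0 \<and> (\<exists>i::nat. 1 \<le> i \<and> (r = 2 * int n - 3 * int i \<or> r = int n - 3 * int i))"
    using ab(2) by (intro conjI exI[of _ "n + 1 - b"]) (auto simp: of_nat_diff)
next
  assume "r > 0 \<and> (\<exists>i::nat. 1 \<le> i \<and> (r = 2 * int n - 3 * int i \<or> r = int n - 3 * int i))"
  then obtain i :: nat where i: "r > 0" "1 \<le> i" "r = 2 * int n - 3 * int i \<or> r = int n - 3 * int i"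
    by blast
  then have "i \<le> n" by linarith
  with i have "r = rank n (1, n + 1 - i) \<or> r = rank n (2, n + 1 - i)"
    by (auto simp: rank_def of_nat_diff)
  moreover have "(1, n + 1 - i) \<in> cells n" "(2, n + 1 - i) \<in> cells n"
    using i(2) \<open>i \<le> n\<close> by (auto simp: cells_def)
  ultimately show "r \<in> ranks n"
    using i(1) unfolding ranks_def by blast
qed

lemma ranks_above_iff:
  assumes cd: "(c, d) \<in> dyck_params n"
  shows "r \<in> rank n ` cells_above n (dyck_path n c d) \<longleftrightarrow>
    (\<exists>i::nat. 1 \<le> i \<and> (i \<le> c + d \<and> r = 2 * int n - 3 * int i \<or> i \<le> c \<and> r = int n - 3 * int i))"
    (is "_ \<longleftrightarrow> ?R")
proof
  have le: "c + d \<le> n" using cd by (auto simp: dyck_params_def)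
  {
    assume "r \<in> rank n ` cells_above n (dyck_path n c d)"
    then obtain b where b: "b \<le> n" "r = rank n (1, b) \<and> n - c - d < b \<or> r = rank n (2, b) \<and> n - c < b"
      unfolding cells_above_dyck_path[OF cd] by auto
    then show ?R
      using le by (intro exI[of _ "n + 1 - b"]) (auto simp: rank_def of_nat_diff)
  next
    assume ?R
    then obtain i :: nat where i: "1 \<le> i"
      "i \<le> c + d \<and> r = 2 * int n - 3 * int i \<or> i \<le> c \<and> r = int n - 3 * int i" by blast
    then have "i \<le> c + d \<and> r = rank n (1, n + 1 - i) \<or> i \<le> c \<and> r = rank n (2, n + 1 - i)"
      using le by (auto simp: rank_def of_nat_diff)
    moreover have "(1, n + 1 - i) \<in> cells_above n (dyck_path n c d)" if "i \<le> c + d"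
      unfolding cells_above_dyck_path[OF cd] using i(1) le that by auto
    moreover have "(2, n + 1 - i) \<in> cells_above n (dyck_path n c d)" if "i \<le> c"
      unfolding cells_above_dyck_path[OF cd] using i(1) le that by auto
    ultimately show "r \<in> rank n ` cells_above n (dyck_path n c d)"
      by blast
  }
qed

text \<open>
  In the proof, \<open>f i\<close> and \<open>g i\<close> are the ranks of the \<open>i\<close>-th cells from the top in the first
  and the second column. Skips are counted by their first entries, whose left neighbours are
  boxed: such an entry is \<open>f i\<close> preceded by \<open>g (i - k)\<close>, or \<open>g i\<close> preceded by
  \<open>f (i + k + 1)\<close>.
\<close>

lemma skip_dyck_path:
  assumes cd: "(c, d) \<in> dyck_params n" and n: "n = 3 * k + e" "e = 1 \<or> e = 2"
  shows "skip n (dyck_path n c d) = (k + c - max (c + d) k) + (c + d - k - 1 - c)"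
proof -
  define f g :: "nat \<Rightarrow> int" where "f i = 2 * int n - 3 * int i" and "g i = int n - 3 * int i" for i
  \<comment> \<open>The difference \<open>f i - g j\<close> equals \<open>n - 3 * (i - j)\<close>.
    It is never zero since 3 does not divide \<open>n\<close>, and it is positive exactly when
    \<open>i - j\<close> is at most the integer part \<open>k\<close> of \<open>n / 3\<close>. This
    fixes how the two columns interleave.\<close>
  have fg: "f i \<noteq> g j" for i j
    using n unfolding f_def g_def by presburger
  have f_less: "f i < f j \<longleftrightarrow> j < i" and g_less: "g i < g j \<longleftrightarrow> j < i" for i j
    by (auto simp: f_def g_def)
  have fg_less: "g j < f i \<longleftrightarrow> i \<le> k + j" for i j
    using n by (auto simp: f_def g_def)
  have gf_less: "f i < g j \<longleftrightarrow> k + j < i" for i j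
    using fg[of i j] fg_less[of j i] by auto
  have f_eq: "f i = f j \<longleftrightarrow> i = j" and g_eq: "g i = g j \<longleftrightarrow> i = j" for i j
    by (auto simp: f_def g_def)
  have le: "c \<le> k" "c + d \<le> 2 * k + e - 1"
    using cd n by (auto simp: dyck_params_def)
  define R where "R = ranks n"
  define B where "B = rank n ` cells_above n (dyck_path n c d)"
  have R: "r \<in> R \<longleftrightarrow> r > 0 \<and> (\<exists>i\<ge>1. r = f i \<or> r = g i)" for r
    unfolding R_def f_def g_def ranks_iff by blast
  have B: "r \<in> B \<longleftrightarrow> (\<exists>i\<ge>1. i \<le> c + d \<and> r = f i \<or> i \<le> c \<and> r = g i)" for r
    unfolding B_def f_def g_def ranks_above_iff[OF cd] by blast
  have f_B: "f i \<in> B \<longleftrightarrow> 1 \<le> i \<and> i \<le> c + d" and g_B: "g i \<in> B \<longleftrightarrow> 1 \<le> i \<and> i \<le> c" for i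
    using fg fg[symmetric] by (auto simp: B f_eq g_eq)
  have f_R: "f i \<in> R" if "1 \<le> i" "i \<le> 2 * k" for i
    using that n by (auto simp: R f_def)
  have g_R: "g i \<in> R" if "1 \<le> i" "i \<le> k" for i
    using that n by (auto simp: R g_def)
  have B_R: "r \<in> R" if "r \<in> B" for r
    using that le n by (auto simp: R B f_def g_def)
  \<comment> \<open>Within a column, a boxed entry forces all larger ranks to be boxed, so an
    unboxed entry with a boxed left neighbour lies in the other column. In both ranges of indices
    the lower bound \<open>c + d\<close> or \<open>c\<close> says that the entry is unboxed, and the
    upper bound that its neighbour is boxed.\<close>
  have "{r \<in> R. r \<notin> B \<and> (\<exists>p \<in> R \<inter> B. p < r \<and> (\<forall>q\<in>R. \<not> (p < q \<and> q < r))) \<and> (\<exists>q \<in> R \<inter> B. r < q)} =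
    f ` {max (c + d) k<..k + c} \<union> g ` {c<..c + d - k - 1}" (is "?L = ?M")
  proof (intro equalityI subsetI)
    fix r assume "r \<in> ?L"
    then obtain p where r: "r \<in> R" "r \<notin> B" and p: "p \<in> R" "p \<in> B" "p < r"
      and gap: "\<And>q. q \<in> R \<Longrightarrow> \<not> (p < q \<and> q < r)" by blast
    obtain i where i: "1 \<le> i" "r = f i \<or> r = g i" using r by (auto simp: R)
    obtain j where j: "1 \<le> j" "j \<le> c + d \<and> p = f j \<or> j \<le> c \<and> p = g j" using p by (auto simp: B)
    show "r \<in> ?M"
    proof (cases "r = f i")
      case True
      then have "i > c + d" using r i f_B by auto
      then have j': "j \<le> c" "p = g j" using j p(3) True f_less by auto
      then have "i \<le> k + j" using p(3) True fg_less by auto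
      \<comment> \<open>For \<open>i <= k\<close> the rank \<open>f (i + 1)\<close> exceeds every
        \<open>g j\<close> with \<open>j >= 1\<close>, so it would separate \<open>p\<close> from
        \<open>r\<close>.\<close>
      moreover have "i > k"
      proof (rule ccontr)
        assume "\<not> i > k"
        then have "p < f (i + 1)" "f (i + 1) < r"
          using j' j(1) True by (auto simp: fg_less f_less)
        moreover have "f (i + 1) \<in> R"
          using \<open>p < f (i + 1)\<close> p(1) R by fastforce
        ultimately show False using gap by blast
      qed
      ultimately show ?thesis using \<open>i > c + d\<close> j' True by auto
    next
      case False
      then have r': "r = g i" "i > c" using i r g_B by auto
      then have j': "j \<le> c + d" "p = f j" using j p(3) g_less by auto
      then have "k + i < j" using p(3) r' gf_less by auto
      then show ?thesis using r' j' by auto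
    qed
  next
    fix r assume "r \<in> ?M"
    then consider i where "r = f i" "max (c + d) k < i" "i \<le> k + c"
      | i where "r = g i" "c < i" "i \<le> c + d - k - 1" by auto
    then show "r \<in> ?L"
    proof cases
      case 1
      have "r \<in> R" "r \<notin> B" using 1 le f_R f_B by auto
      \<comment> \<open>\<open>f 1\<close> is the largest rank; it is boxed because the bounds on
        \<open>i\<close> force \<open>c >= 1\<close>. It serves as the boxed entry to the
        right.\<close>
      moreover have "g (i - k) \<in> B" "g (i - k) < r" "f 1 \<in> B" "r < f 1"
        using 1 by (auto simp: g_B fg_less f_B f_less)
      moreover have "\<not> (g (i - k) < q \<and> q < r)" if "q \<in> R" for q
        using that 1 by (auto simp: R g_less gf_less fg_less f_less)
      ultimately show ?thesis using B_R by blast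
    next
      case 2
      have "r \<in> R" "r \<notin> B" using 2 le n(2) g_R g_B by auto
      moreover have "f (i + k + 1) \<in> B" "f (i + k + 1) < r" "f 1 \<in> B" "r < f 1"
        using 2 by (auto simp: gf_less fg_less f_B f_less)
      moreover have "\<not> (f (i + k + 1) < q \<and> q < r)" if "q \<in> R" for q
        using that 2 by (auto simp: R g_less gf_less fg_less f_less)
      ultimately show ?thesis using B_R by blast
    qed
  qed
  moreover have "card ?M = (k + c - max (c + d) k) + (c + d - k - 1 - c)"
    using fg by (subst card_Un_disjoint) (auto simp: card_image inj_on_def f_eq g_eq)
  ultimately show ?thesis
    unfolding skip_eq_card_ranks R_def B_def by argo
qed

section \<open>The triples of statistics and the exchange of area and dinv\<close>

definition stat_triples :: "nat \<Rightarrow> (nat \<times> nat \<times> nat) set" where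
  "stat_triples n = {(a, v, s). a + v + s = n - 1 \<and> s \<le> a \<and> s \<le> v}"

lemma bij_betw_stats:
  assumes n: "n = 3 * k + e" "e = 1 \<or> e = 2"
  shows "bij_betw (\<lambda>P. (area n P, dinv n P, skip n P)) (dyck_paths n) (stat_triples n)"
proof -
  let ?st = "\<lambda>P. (area n P, dinv n P, skip n P)"
  let ?p = "\<lambda>(c, d). dyck_path n c d"
  let ?f = "\<lambda>(c, d). (n - 1 - 2 * c - d, c + min d (k + 1) + (c + d - max d k),
    (k + c - max (c + d) k) + (c + d - k - 1 - c))"
  have st: "?st (?p x) = ?f x" if "x \<in> dyck_params n" for x
  proof -
    obtain c d where x: "x = (c, d)" by force
    show ?thesis
      using that unfolding x prod.case
      by (simp only: area_dyck_path[OF _ n] dinv_dyck_path[OF _ n] skip_dyck_path[OF _ n])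
  qed
  have params: "(c, d) \<in> dyck_params n \<longleftrightarrow> c \<le> k \<and> c + d \<le> 2 * k + e - 1" for c d
    using n by (auto simp: dyck_params_def)
  \<comment> \<open>On each of these three regions \<open>?f\<close> is affine. The value
    \<open>v\<close> of dinv tells them apart: \<open>v <= k\<close> in the first,
    \<open>v - k\<close> even in the second, \<open>v - k\<close> odd in the third. The first two
    overlap where \<open>c + d = k\<close>, and there the formulas agree.\<close>
  have small_d: "?f (c, d) = (n - 1 - 2 * c - d, c + d, c)" if "c + d \<le> k" for c d
    using that by simp
  have large_sum: "?f (c, d) = (n - 1 - 2 * c - d, 2 * (c + d) - k, k - d)"
    if "c \<le> k" "d \<le> k" "k \<le> c + d" for c d
    using that by simp
  have large_d: "?f (c, d) = (n - 1 - 2 * c - d, 2 * c + k + 1, d - k - 1)"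
    if "c \<le> k" "k < d" for c d
    using that by simp
  \<comment> \<open>The inverse solves the affine formulas of the respective region for
    \<open>c\<close> and \<open>d\<close> from \<open>v\<close> and \<open>s\<close>;
    \<open>a\<close> is recovered from the sum \<open>n - 1\<close>.\<close>
  let ?g = "\<lambda>(a, v, s). if v \<le> k then (s, v - s)
    else if even (v - k) then (s + (v - k) div 2, k - s) else ((v - k) div 2, s + k + 1)"
  have gf: "?g (?f (c, d)) = (c, d) \<and> ?f (c, d) \<in> stat_triples n" if "(c, d) \<in> dyck_params n" for c d
  proof -
    have cd: "c \<le> k" "c + d \<le> 2 * k + e - 1" using that params by auto
    consider "c + d \<le> k" | "d \<le> k" "k < c + d" | "k < d" by linarith
    then show ?thesis
    proof cases
      case 1
      show ?thesis unfolding small_d[OF 1] using 1 cd n by (auto simp: stat_triples_def)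
    next
      case 2
      then have "k \<le> c + d" by simp
      have "2 * (c + d) - k - k = 2 * (c + d - k)" by simp
      then show ?thesis
        unfolding large_sum[OF cd(1) 2(1) \<open>k \<le> c + d\<close>] using 2 cd n
        by (auto simp: stat_triples_def)
    next
      case 3
      show ?thesis
        unfolding large_d[OF cd(1) 3] using 3 cd n by (auto simp: stat_triples_def)
    qed
  qed
  have fg: "?f (?g (a, v, s)) = (a, v, s) \<and> ?g (a, v, s) \<in> dyck_params n"
    if "(a, v, s) \<in> stat_triples n" for a v s
  proof -
    have sum: "a + v + s = 3 * k + e - 1" and le: "s \<le> a" "s \<le> v"
      using that n by (auto simp: stat_triples_def)
    consider "v \<le> k" | j where "v = k + 2 * j" "j > 0" | j where "v = k + 2 * j + 1"
    proof -
      obtain j where "v - k = 2 * j \<or> v - k = 2 * j + 1" by (metis oddE evenE)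
      then show thesis
        using that(1) that(2)[of j] that(3)[of j] by (cases "v \<le> k") auto
    qed
    then show ?thesis
    proof cases
      case 1
      then have "(s, v - s) \<in> dyck_params n"
        unfolding params using sum le n by auto
      then show ?thesis
        using 1 small_d[of s "v - s"] sum le n by auto
    next
      case 2
      \<comment> \<open>Inserting \<open>s <= a\<close> into the sum gives
        \<open>2 * s + v <= 3 * k + e - 1\<close>. With \<open>v = k + 2 * j\<close> and
        \<open>e <= 2\<close> this rounds down to \<open>s + j <= k\<close>. The odd case below uses
        the same estimate.\<close>
      then have "s + j \<le> k" "k - s \<le> k" "k \<le> s + j + (k - s)"
        using sum le n by auto
      moreover from this have "(s + j, k - s) \<in> dyck_params n"
        unfolding params using 2 sum le n by auto
      ultimately show ?thesis
        using large_sum[of "s + j" "k - s"] 2 sum le n by auto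
    next
      case 3
      then have "j \<le> k" "k < s + k + 1"
        using sum le n by auto
      moreover from this have "(j, s + k + 1) \<in> dyck_params n"
        unfolding params using 3 sum le n by auto
      ultimately show ?thesis
        using large_d[of j "s + k + 1"] 3 sum le n by auto
    qed
  qed
  have "?g (?f x) = x \<and> ?f x \<in> stat_triples n" if "x \<in> dyck_params n" for x
    using gf[of "fst x" "snd x"] that by (simp only: prod.collapse)
  moreover have "?f (?g y) = y \<and> ?g y \<in> dyck_params n" if "y \<in> stat_triples n" for y
    using fg[of "fst y" "fst (snd y)" "snd (snd y)"] that by (simp only: prod.collapse)
  ultimately have "bij_betw ?f (dyck_params n) (stat_triples n)"
    by (intro bij_betw_byWitness[where f' = ?g]) blast+
  moreover have "(?st \<circ> ?p) x = ?f x" if "x \<in> dyck_params n" for x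
    unfolding comp_apply using that by (rule st)
  ultimately have "bij_betw (?st \<circ> ?p) (dyck_params n) (stat_triples n)"
    using bij_betw_cong[of "dyck_params n" "?st \<circ> ?p" ?f] by simp
  then have inj: "inj_on (?st \<circ> ?p) (dyck_params n)"
    and image: "(?st \<circ> ?p) ` dyck_params n = stat_triples n"
    by (simp_all only: bij_betw_def)
  show ?thesis
    unfolding dyck_paths_eq bij_betw_def image_comp
    by (rule conjI[OF inj_on_imageI[OF inj] image])
qed

text \<open>Injectivity of \<open>st\<close> forces \<open>\<phi>\<close> to be the conjugate of
  \<open>sw\<close> by \<open>st\<close> on \<open>A\<close>. Extensionality fixes the values
  outside \<open>A\<close>, so that uniqueness holds as an equality of total functions.\<close>

lemma ex1_bij_transporting_bij:
  assumes st: "bij_betw st A T" and sw: "bij_betw sw T T"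
  shows "\<exists>!\<phi>. \<phi> \<in> extensional A \<and> bij_betw \<phi> A A \<and> (\<forall>x\<in>A. st (\<phi> x) = sw (st x))"
proof (rule ex1I)
  let ?\<phi> = "restrict (inv_into A st \<circ> (sw \<circ> st)) A"
  have "bij_betw (inv_into A st \<circ> (sw \<circ> st)) A A"
    using bij_betw_trans[OF bij_betw_trans[OF st sw] bij_betw_inv_into[OF st]] .
  then have "bij_betw ?\<phi> A A"
    by (subst bij_betw_cong[of A _ "inv_into A st \<circ> (sw \<circ> st)"]) auto
  moreover have "st (?\<phi> x) = sw (st x)" if "x \<in> A" for x
    using that st sw by (simp add: bij_betw_def f_inv_into_f rev_image_eqI) (metis f_inv_into_f imageI)
  ultimately show "?\<phi> \<in> extensional A \<and> bij_betw ?\<phi> A A \<and> (\<forall>x\<in>A. st (?\<phi> x) = sw (st x))"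
    by simp
  fix \<psi> assume \<psi>: "\<psi> \<in> extensional A \<and> bij_betw \<psi> A A \<and> (\<forall>x\<in>A. st (\<psi> x) = sw (st x))"
  show "\<psi> = ?\<phi>"
  proof (rule extensionalityI[of _ A])
    fix x assume x: "x \<in> A"
    then have "\<psi> x \<in> A" using \<psi> by (auto simp: bij_betw_def)
    then have "\<psi> x = inv_into A st (st (\<psi> x))"
      using st by (simp add: bij_betw_def inv_into_f_f)
    then show "\<psi> x = ?\<phi> x" using \<psi> x by simp
  qed (use \<psi> in auto)
qed

theorem mainTheorem2:
  fixes n :: nat
  assumes "n \<ge> 1" and "\<not> 3 dvd n"
  shows "\<exists>!\<phi>. \<phi> \<in> extensional (dyck_paths n) \<and>
           bij_betw \<phi> (dyck_paths n) (dyck_paths n) \<and>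
           (\<forall>P\<in>dyck_paths n.
              area n (\<phi> P) = dinv n P \<and>
              dinv n (\<phi> P) = area n P \<and>
              skip n (\<phi> P) = skip n P)"
proof -
  have n: "n = 3 * (n div 3) + n mod 3" "n mod 3 = 1 \<or> n mod 3 = 2"
    using assms(2) by presburger+
  let ?sw = "\<lambda>(a, v, s). (v, a, s) :: nat \<times> nat \<times> nat"
  have "bij_betw ?sw (stat_triples n) (stat_triples n)"
    by (rule bij_betw_byWitness[where f' = ?sw]) (auto simp: stat_triples_def)
  from ex1_bij_transporting_bij[OF bij_betw_stats[OF n] this] show ?thesis
    by simp
qed

end
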